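(* Let $D\subset\mathbb{R}^2$ be open and let $f,\nu:D\to\mathbb{R}^4\setminus\{0\}$ be smooth with $\langle f,\nu\rangle=0$, related by the projective Lelieuvre map, i.e. $f\wedge f_x=\star(\nu\wedge\nu_x)$ and $f\wedge f_y=-\star(\nu\wedge\nu_y)$ on $D$. Assume that $\det|\nu,\nu_x,\nu_y,\nu_{xy}|$ vanishes nowhere on $D$. Then there exist functions $U_1,V_1,W_1,\tilde W_1,U_2,V_2,W_2,\tilde W_2:D\to\mathbb{R}$ such that $$\nu_{xx}=U_1\nu_x+V_1\nu_y+W_1\nu,\qquad \nu_{yy}=U_2\nu_x+V_2\nu_y+W_2\nu$$ and $$f_{xx}=U_1f_x-V_1f_y+\tilde W_1f,\qquad f_{yy}=-U_2f_x+V_2f_y+\tilde W_2f,$$ where $$V_1^2=\frac{\det|\nu,\nu_x,\nu_{xx},\nu_{xxx}|}{\det|\nu,\nu_x,\nu_y,\nu_{xy}|},\qquad U_2^2=-\frac{\det|\nu,\nu_y,\nu_{yy},\nu_{yyy}|}{\det|\nu,\nu_x,\nu_y,\nu_{xy}|}.$$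
   Context: $f=(f_1,\dots,f_4)$ and $\nu=(\nu_1,\dots,\nu_4)$ are homogeneous coordinate vectors of surfaces in $P^3$ and in the dual space $P_3$, depending on real variables $(x,y)$; subscripts $x,y$ on $f$ and $\nu$ denote partial derivatives; $\langle f,\nu\rangle=\sum_i f_i\nu_i$. $\varepsilon$ is the totally alternating symbol with $\varepsilon_{1234}=1$. For $a,b\in\mathbb{R}^4$, $(a\wedge b)_{ik}=a_ib_k-a_kb_i$; for a skew-symmetric $T$, $(\star T)_{ik}=\frac12\sum_{l,m}\varepsilon_{lmik}T_{lm}$. Thus the two equations of the map read $f_if_{k,x}-f_kf_{i,x}=\sum_{l,m}\varepsilon_{iklm}\nu_l\nu_{m,x}$ and $f_if_{k,y}-f_kf_{i,y}=-\sum_{l,m}\varepsilon_{iklm}\nu_l\nu_{m,y}$ for $i,k=1,\dots,4$. $\det|a_1,a_2,a_3,a_4|$ is the determinant of the matrix formed by the four vectors. *)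

theory Defs
  imports "HOL-Analysis.Analysis" "HOL-Combinatorics.Combinatorics"
begin

definition ddx :: "(real \<times> real \<Rightarrow> real ^ 'n) \<Rightarrow> real \<times> real \<Rightarrow> real ^ 'n" where
  "ddx g p = vector_derivative (\<lambda>t. g (t, snd p)) (at (fst p))"

definition ddy :: "(real \<times> real \<Rightarrow> real ^ 'n) \<Rightarrow> real \<times> real \<Rightarrow> real ^ 'n" where
  "ddy g p = vector_derivative (\<lambda>t. g (fst p, t)) (at (snd p))"

text \<open>Continuous differentiability of order \<open>k\<close>, meant for open \<open>D\<close>.\<close>

fun Ck_on :: "nat \<Rightarrow> (real \<times> real) set \<Rightarrow> (real \<times> real \<Rightarrow> real ^ 'n) \<Rightarrow> bool" where
  "Ck_on 0 D g \<longleftrightarrow> continuous_on D g"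
| "Ck_on (Suc k) D g \<longleftrightarrow> g differentiable_on D \<and> Ck_on k D (ddx g) \<and> Ck_on k D (ddy g)"

definition smooth_on :: "(real \<times> real) set \<Rightarrow> (real \<times> real \<Rightarrow> real ^ 'n) \<Rightarrow> bool" where
  "smooth_on D g \<longleftrightarrow> (\<forall>k. Ck_on k D g)"

text \<open>The index type \<open>4\<close> consists of \<open>1, 2, 3, 4\<close>, where \<open>4 = 0\<close>. For distinct
  indices the symbol is the sign of the permutation \<open>1 \<mapsto> i, 2 \<mapsto> k, 3 \<mapsto> l, 4 \<mapsto> m\<close>.\<close>

definition levi_civita :: "4 \<Rightarrow> 4 \<Rightarrow> 4 \<Rightarrow> 4 \<Rightarrow> real" where
  "levi_civita i k l m =
    (if distinct [i, k, l, m]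
     then of_int (sign (\<lambda>j::4. if j = 1 then i else if j = 2 then k else if j = 3 then l else m))
     else 0)"

definition wedge :: "real ^ 4 \<Rightarrow> real ^ 4 \<Rightarrow> real ^ 4 ^ 4" where
  "wedge a b = (\<chi> i k. a $ i * b $ k - a $ k * b $ i)"

definition hodge_star :: "real ^ 4 ^ 4 \<Rightarrow> real ^ 4 ^ 4" where
  "hodge_star T = (\<chi> i k. 1 / 2 * (\<Sum>l\<in>UNIV. \<Sum>m\<in>UNIV. levi_civita l m i k * T $ l $ m))"

definition det4 :: "real ^ 4 \<Rightarrow> real ^ 4 \<Rightarrow> real ^ 4 \<Rightarrow> real ^ 4 \<Rightarrow> real" where
  "det4 a b c d = det (vector [a, b, c, d] :: real ^ 4 ^ 4)"

lemma levi_civita_1234: "levi_civita 1 2 3 4 = 1"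
proof -
  have "(\<lambda>j::4. if j = 1 then 1 else if j = 2 then 2 else if j = 3 then 3 else 4) = id"
    using exhaust_4 by fastforce
  then show ?thesis
    by (simp add: levi_civita_def)
qed

end

theory Submission
  imports Defs
begin

text \<open>
  Contracting the Lelieuvre equations with vectors \<open>a\<close>, \<open>b\<close> turns them into
  \<open>\<langle>f,a\<rangle>\<langle>f\<^sub>x,b\<rangle> - \<langle>f\<^sub>x,a\<rangle>\<langle>f,b\<rangle> = |\<nu>,\<nu>\<^sub>x,a,b|\<close> and the analogue for \<open>y\<close> with the opposite
  sign. With \<open>a = f\<close> this gives \<open>\<langle>f\<^sub>x,\<nu>\<rangle> = \<langle>f\<^sub>x,\<nu>\<^sub>x\<rangle> = 0\<close> and, writing \<open>r = \<langle>f\<^sub>x,\<nu>\<^sub>y\<rangle>\<close>, also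
  \<open>r = \<langle>f\<^sub>y,\<nu>\<^sub>x\<rangle>\<close>. Differentiating the orthogonality relations yields \<open>\<langle>f,\<nu>\<^sub>x\<^sub>x\<rangle> = 0\<close>, so \<open>\<nu>\<^sub>x\<^sub>x\<close>
  has no component along \<open>\<nu>\<^sub>x\<^sub>y\<close> in the basis \<open>\<nu>, \<nu>\<^sub>x, \<nu>\<^sub>y, \<nu>\<^sub>x\<^sub>y\<close>. Since
  \<open>f \<and> f\<^sub>x\<^sub>x = \<star>(\<nu> \<and> \<nu>\<^sub>x\<^sub>x) = f \<and> (U\<^sub>1 f\<^sub>x - V\<^sub>1 f\<^sub>y)\<close>, the equation for \<open>f\<^sub>x\<^sub>x\<close> has the same coefficients up
  to sign. Finally \<open>|\<nu>,\<nu>\<^sub>x,\<nu>\<^sub>y,w| = - r \<langle>f,w\<rangle>\<close>, together with \<open>\<langle>f,\<nu>\<^sub>x\<^sub>y\<rangle> = - r\<close> and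
  \<open>\<langle>f,\<nu>\<^sub>x\<^sub>x\<^sub>x\<rangle> = - V\<^sub>1 r\<close>, evaluates the determinants without differentiating \<open>U\<^sub>1, V\<^sub>1, W\<^sub>1\<close>.
\<close>

section \<open>The determinant as an alternating 4-linear form, and the symbol as its values on the
  basis\<close>

lemma vector_4 [simp]:
  "(vector [a, b, c, d] :: 'a::zero ^ 4) $ 1 = a"
  "(vector [a, b, c, d] :: 'a ^ 4) $ 2 = b"
  "(vector [a, b, c, d] :: 'a ^ 4) $ 3 = c"
  "(vector [a, b, c, d] :: 'a ^ 4) $ 4 = d"
  unfolding vector_def by simp_all

lemma linear_det4:
  "linear (\<lambda>a. det4 a b c d)" "linear (\<lambda>b. det4 a b c d)"
  "linear (\<lambda>c. det4 a b c d)" "linear (\<lambda>d. det4 a b c d)"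
proof -
  have 1: "linear (\<lambda>x. det ((\<chi> i. if i = k then x else r i) :: real^4^4))" for k and r :: "4 \<Rightarrow> real^4"
  proof (rule linearI)
    show "det ((\<chi> i. if i = k then x + y else r i) :: real^4^4) =
        det (\<chi> i. if i = k then x else r i) + det (\<chi> i. if i = k then y else r i)" for x y
      using det_row_add[of k "\<lambda>_. x" "\<lambda>_. y" r] by simp
    show "det ((\<chi> i. if i = k then t *\<^sub>R x else r i) :: real^4^4) =
        t *\<^sub>R det (\<chi> i. if i = k then x else r i)" for t x
      using det_row_mul[of k t "\<lambda>_. x" r] unfolding scalar_mult_eq_scaleR by simp
  qed
  \<comment> \<open>The slot under study becomes an overwritten row; the 0 put there is an arbitrary
    placeholder.\<close>
  have v: "det4 a b c d = det ((\<chi> i. if i = 1 then a else vector [0,b,c,d] $ i) :: real^4^4)"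
     "det4 a b c d = det ((\<chi> i. if i = 2 then b else vector [a,0,c,d] $ i) :: real^4^4)"
     "det4 a b c d = det ((\<chi> i. if i = 3 then c else vector [a,b,0,d] $ i) :: real^4^4)"
     "det4 a b c d = det ((\<chi> i. if i = 4 then d else vector [a,b,c,0] $ i) :: real^4^4)" for a b c d
    unfolding det4_def by (rule arg_cong[of _ _ det], unfold vec_eq_iff[where 'a="real^4"] forall_4, simp)+
  show "linear (\<lambda>a. det4 a b c d)" unfolding v(1) by (rule 1)
  show "linear (\<lambda>b. det4 a b c d)" unfolding v(2) by (rule 1)
  show "linear (\<lambda>c. det4 a b c d)" unfolding v(3) by (rule 1)
  show "linear (\<lambda>d. det4 a b c d)" unfolding v(4) by (rule 1)
qed

lemmas det4_linear_simps =
  linear_add[OF linear_det4(1)] linear_add[OF linear_det4(2)]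
  linear_add[OF linear_det4(3)] linear_add[OF linear_det4(4)]
  linear_scale[OF linear_det4(1)] linear_scale[OF linear_det4(2)]
  linear_scale[OF linear_det4(3)] linear_scale[OF linear_det4(4)]

lemma det4_identical [simp]:
  "det4 a a c d = 0" "det4 a b a d = 0" "det4 a b c a = 0"
  "det4 a b b d = 0" "det4 a b c b = 0" "det4 a b c c = 0"
  unfolding det4_def
  using det_identical_rows[of 1 2 "vector [a,a,c,d] :: real^4^4"]
    det_identical_rows[of 1 3 "vector [a,b,a,d] :: real^4^4"]
    det_identical_rows[of 1 4 "vector [a,b,c,a] :: real^4^4"]
    det_identical_rows[of 2 3 "vector [a,b,b,d] :: real^4^4"]
    det_identical_rows[of 2 4 "vector [a,b,c,b] :: real^4^4"]
    det_identical_rows[of 3 4 "vector [a,b,c,c] :: real^4^4"]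
  by (simp_all add: row_def)

text \<open>Polarization: expand a determinant in which a sum of two vectors fills two adjacent
  slots.\<close>

lemma det4_swap:
  "det4 b a c d = - det4 a b c d" "det4 a c b d = - det4 a b c d" "det4 a b d c = - det4 a b c d"
  using det4_identical(1)[of "a + b" c d] det4_identical(4)[of a "b + c" d]
    det4_identical(6)[of a b "c + d"]
  unfolding det4_linear_simps by simp_all

text \<open>For distinct indices the rows are those of the identity matrix permuted by
  \<open>p\<close>, so the determinant is the sign of \<open>p\<close>; a repeated index gives two
  equal rows.\<close>

lemma levi_civita_eq_det4:
  "levi_civita i k l m = det4 (axis i 1) (axis k 1) (axis l 1) (axis m 1)"
proof (cases "distinct [i, k, l, m]")
  case True
  define p where "p = (\<lambda>j::4. if j = 1 then i else if j = 2 then k else if j = 3 then l else m)"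
  have p: "p 1 = i" "p 2 = k" "p 3 = l" "p 4 = m" by (simp_all add: p_def)
  have "inj p" using True unfolding inj_def forall_4 p by auto
  then have "p permutes UNIV" 
    by (intro bij_imp_permutes) (auto simp: bij_def finite_UNIV_inj_surj)
  then have "det ((\<chi> j. mat 1 $ p j) :: real^4^4) = of_int (sign p)"
    by (simp add: det_permute_rows)
  moreover have "mat 1 $ j = (axis j 1 :: real^4)" for j
    by (simp add: mat_def axis_def vec_eq_iff)
  then have "(\<chi> j. (mat 1 $ p j :: real^4)) = vector [axis i 1, axis k 1, axis l 1, axis m 1]"
    unfolding vec_eq_iff[where 'a="real^4"] forall_4 by (simp add: p)
  ultimately show ?thesis
    using True by (simp add: levi_civita_def det4_def p_def)
next
  case False
  then show ?thesis by (auto simp: levi_civita_def)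
qed

section \<open>Contraction of wedge and star with vectors\<close>

lemma linear_axis_expansion:
  fixes g :: "real ^ 'n \<Rightarrow> real"
  assumes "linear g"
  shows "(\<Sum>i\<in>UNIV. x $ i * g (axis i 1)) = g x"
proof -
  have "g x = g (\<Sum>i\<in>UNIV. x $ i *\<^sub>R axis i 1)"
    using basis_expansion[of x] by (simp add: scalar_mult_eq_scaleR)
  then show ?thesis by (simp add: linear_sum[OF assms] linear_scale[OF assms])
qed

text \<open>By alternation both terms of \<open>wedge u v\<close> contribute the same determinant,
  which cancels the factor 1/2.\<close>

lemma hodge_star_wedge_nth:
  "hodge_star (wedge u v) $ i $ k = det4 u v (axis i 1) (axis k 1)"
proof -
  let ?d = "\<lambda>x y. det4 x y (axis i 1) (axis k 1)"
  have E: "(\<Sum>l\<in>UNIV. \<Sum>m\<in>UNIV. levi_civita l m i k * (x $ l * y $ m)) = ?d x y" for x y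
  proof -
    have "(\<Sum>l\<in>UNIV. \<Sum>m\<in>UNIV. levi_civita l m i k * (x $ l * y $ m)) =
        (\<Sum>l\<in>UNIV. x $ l * (\<Sum>m\<in>UNIV. y $ m * ?d (axis l 1) (axis m 1)))"
      by (simp add: levi_civita_eq_det4 sum_distrib_left mult_ac)
    also have "\<dots> = ?d x y"
      by (simp add: linear_axis_expansion[OF linear_det4(1)] linear_axis_expansion[OF linear_det4(2)])
    finally show ?thesis .
  qed
  have "(\<Sum>l\<in>UNIV. \<Sum>m\<in>UNIV. levi_civita l m i k * (u $ m * v $ l)) = - ?d u v"
    using E[of v u] by (simp add: det4_swap(1)[of v u] mult_ac)
  then show ?thesis
    by (simp add: hodge_star_def wedge_def right_diff_distrib sum_subtractf E)
qed

text \<open>Together with \<open>inner_wedge\<close>, this turns the Lelieuvre equations into scalar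
  identities with freely chosen test vectors \<open>a\<close> and \<open>b\<close>.\<close>

lemma inner_hodge_star_wedge:
  "a \<bullet> (hodge_star (wedge u v) *v b) = det4 u v a b"
proof -
  have "a \<bullet> (hodge_star (wedge u v) *v b) =
      (\<Sum>i\<in>UNIV. a $ i * (\<Sum>k\<in>UNIV. b $ k * det4 u v (axis i 1) (axis k 1)))"
    by (simp add: inner_vec_def matrix_vector_mult_def hodge_star_wedge_nth mult_ac)
  also have "\<dots> = det4 u v a b"
    by (simp add: linear_axis_expansion[OF linear_det4(3)] linear_axis_expansion[OF linear_det4(4)])
  finally show ?thesis .
qed

lemma inner_wedge: "a \<bullet> (wedge u v *v b) = (u \<bullet> a) * (v \<bullet> b) - (v \<bullet> a) * (u \<bullet> b)"
proof -
  have "wedge u v *v b = (v \<bullet> b) *\<^sub>R u - (u \<bullet> b) *\<^sub>R v"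
    by (simp add: vec_eq_iff inner_vec_def matrix_vector_mult_def wedge_def sum_subtractf
        sum_distrib_left right_diff_distrib mult_ac)
  then show ?thesis by (simp add: inner_diff_right inner_commute mult_ac)
qed

section \<open>Bases, parallel vectors, and linearity of wedge and star\<close>

lemma det4_nonzero_spans:
  assumes "det4 a b c d \<noteq> 0"
  obtains \<alpha> \<beta> \<gamma> \<delta> where "w = \<alpha> *\<^sub>R a + \<beta> *\<^sub>R b + \<gamma> *\<^sub>R c + \<delta> *\<^sub>R d"
proof -
  let ?P = "transpose (vector [a, b, c, d] :: real^4^4)"
  have "invertible ?P"
    using assms by (simp add: invertible_det_nz det_transpose det4_def)
  then obtain Q where "?P ** Q = mat 1" by (auto simp: invertible_def)
  then have "?P *v (Q *v w) = w" by (simp add: matrix_vector_mul_assoc)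
  moreover have "?P *v x = x $ 1 *\<^sub>R a + x $ 2 *\<^sub>R b + x $ 3 *\<^sub>R c + x $ 4 *\<^sub>R d" for x
    by (simp add: vec_eq_iff matrix_vector_mult_def transpose_def sum_4 mult_ac)
  ultimately show thesis using that by metis
qed

text \<open>Contracting with \<open>u\<close> in the first slot gives (u \<bullet> u)(v \<bullet> b)
  = (v \<bullet> u)(u \<bullet> b) for all b, so v is its own projection onto u.\<close>

lemma wedge_eq_0_imp_multiple:
  assumes "wedge u v = 0" and "u \<noteq> 0"
  obtains c where "v = c *\<^sub>R u"
proof
  have "(u \<bullet> a) * (v \<bullet> b) = (v \<bullet> a) * (u \<bullet> b)" for a b
    using inner_wedge[of a u v b] assms(1) by simp
  from this[of u] have "v \<bullet> b = (((v \<bullet> u) / (u \<bullet> u)) *\<^sub>R u) \<bullet> b" for b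
    using assms(2) by (simp add: field_simps)
  then show "v = ((v \<bullet> u) / (u \<bullet> u)) *\<^sub>R u"
    by (metis vector_eq_rdot)
qed

lemma linear_wedge_right: "linear (wedge u)"
  by (rule linearI) (simp_all add: wedge_def vec_eq_iff algebra_simps)

lemma bounded_bilinear_wedge: "bounded_bilinear wedge"
  unfolding bilinear_conv_bounded_bilinear[symmetric] bilinear_def
  by (auto intro!: linear_wedge_right linearI simp: wedge_def vec_eq_iff algebra_simps)

lemma linear_hodge_star: "linear hodge_star"
  by (rule linearI)
    (simp_all add: hodge_star_def vec_eq_iff algebra_simps sum.distrib sum_distrib_left)

section \<open>Differentiating identities along the coordinate lines\<close>

lemma eventually_slices:
  assumes "open D" and "p \<in> D"
  shows "\<forall>\<^sub>F t in nhds (fst p). (t, snd p) \<in> D" and "\<forall>\<^sub>F t in nhds (snd p). (fst p, t) \<in> D"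
proof -
  have "((\<lambda>t. (t, snd p)) \<longlongrightarrow> (fst p, snd p)) (nhds (fst p))"
    "((\<lambda>t. (fst p, t)) \<longlongrightarrow> (fst p, snd p)) (nhds (snd p))"
    by (intro tendsto_intros filterlim_ident)+
  then show "\<forall>\<^sub>F t in nhds (fst p). (t, snd p) \<in> D" and "\<forall>\<^sub>F t in nhds (snd p). (fst p, t) \<in> D"
    using assms by (auto dest!: topological_tendstoD)
qed

text \<open>Identities valid on \<open>D\<close> give agreement on a slice only near the point,
  which is enough to compare derivatives there.\<close>

lemma has_vector_derivative_unique_ev:
  assumes "(h has_vector_derivative h') (at t)" and "(k has_vector_derivative k') (at t)"
    and "\<forall>\<^sub>F s in nhds t. h s = k s"
  shows "h' = k'"
proof -
  have "(k has_vector_derivative h') (at t)"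
    using assms(1) has_vector_derivative_cong_ev[of UNIV h k t h'] assms(3)
      eventually_nhds_x_imp_x[OF assms(3)] by simp
  then show ?thesis using assms(2) by (rule vector_derivative_unique_at)
qed

lemma has_vector_derivative_ddx_ddy:
  assumes "open D" and "p \<in> D" and "smooth_on D g"
  shows "((\<lambda>t. g (t, snd p)) has_vector_derivative ddx g p) (at (fst p))"
    and "((\<lambda>t. g (fst p, t)) has_vector_derivative ddy g p) (at (snd p))"
proof -
  have "g differentiable_on D"
    using assms(3) by (metis Ck_on.simps(2) smooth_on_def)
  then have g: "g differentiable (at (fst p, snd p))"
    using assms(1,2) by (simp add: differentiable_on_eq_differentiable_at)
  have "(\<lambda>t. (t, snd p)) differentiable (at (fst p))" "(\<lambda>t. (fst p, t)) differentiable (at (snd p))"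
    by (auto intro!: differentiableI derivative_eq_intros)
  with g have "(\<lambda>t. g (t, snd p)) differentiable (at (fst p))" "(\<lambda>t. g (fst p, t)) differentiable (at (snd p))"
    using differentiable_compose[of g "\<lambda>t. (t, snd p)" "fst p" UNIV]
      differentiable_compose[of g "\<lambda>t. (fst p, t)" "snd p" UNIV] by simp_all
  then show "((\<lambda>t. g (t, snd p)) has_vector_derivative ddx g p) (at (fst p))"
    and "((\<lambda>t. g (fst p, t)) has_vector_derivative ddy g p) (at (snd p))"
    by (simp_all add: ddx_def ddy_def vector_derivative_works)
qed

lemma smooth_on_ddx: "smooth_on D g \<Longrightarrow> smooth_on D (ddx g)"
  and smooth_on_ddy: "smooth_on D g \<Longrightarrow> smooth_on D (ddy g)"
  by (metis Ck_on.simps(2) smooth_on_def)+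

lemma inner_eq_0_derivatives:
  assumes "open D" and "smooth_on D u" and "smooth_on D v"
    and "\<And>q. q \<in> D \<Longrightarrow> u q \<bullet> v q = 0" and "p \<in> D"
  shows "u p \<bullet> ddx v p + ddx u p \<bullet> v p = 0" and "u p \<bullet> ddy v p + ddy u p \<bullet> v p = 0"
proof -
  note slices = eventually_slices[OF assms(1,5)]
  note deriv = bounded_bilinear.has_vector_derivative[OF bounded_bilinear_inner]
  show "u p \<bullet> ddx v p + ddx u p \<bullet> v p = 0"
    using has_vector_derivative_unique_ev[OF
        deriv[OF has_vector_derivative_ddx_ddy(1)[OF assms(1,5,2)]
          has_vector_derivative_ddx_ddy(1)[OF assms(1,5,3)]]
        has_vector_derivative_const[of 0]]
      eventually_mono[OF slices(1) assms(4)] by simp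
  show "u p \<bullet> ddy v p + ddy u p \<bullet> v p = 0"
    using has_vector_derivative_unique_ev[OF
        deriv[OF has_vector_derivative_ddx_ddy(2)[OF assms(1,5,2)]
          has_vector_derivative_ddx_ddy(2)[OF assms(1,5,3)]]
        has_vector_derivative_const[of 0]]
      eventually_mono[OF slices(2) assms(4)] by simp
qed

lemma wedge_self [simp]: "wedge u u = 0"
  by (simp add: wedge_def vec_eq_iff)

text \<open>In the product rule the terms \<open>wedge (ddx f p) (ddx f p)\<close> and their
  analogues vanish. A general \<open>L\<close> covers both the star and its negative.\<close>

lemma lelieuvre_derivatives:
  assumes "open D" and "smooth_on D f" and "smooth_on D \<nu>" and "linear L" and "p \<in> D"
  shows "(\<And>q. q \<in> D \<Longrightarrow> wedge (f q) (ddx f q) = L (wedge (\<nu> q) (ddx \<nu> q))) \<Longrightarrow>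
      wedge (f p) (ddx (ddx f) p) = L (wedge (\<nu> p) (ddx (ddx \<nu>) p))"
    and "(\<And>q. q \<in> D \<Longrightarrow> wedge (f q) (ddy f q) = L (wedge (\<nu> q) (ddy \<nu> q))) \<Longrightarrow>
      wedge (f p) (ddy (ddy f) p) = L (wedge (\<nu> p) (ddy (ddy \<nu>) p))"
proof -
  note slices = eventually_slices[OF assms(1,5)]
  note wedge = bounded_bilinear.has_vector_derivative[OF bounded_bilinear_wedge]
  note L = bounded_linear.has_vector_derivative[OF assms(4)[unfolded linear_conv_bounded_linear]]
  note dx = has_vector_derivative_ddx_ddy(1)[OF assms(1,5)]
  note dy = has_vector_derivative_ddx_ddy(2)[OF assms(1,5)]
  show "wedge (f p) (ddx (ddx f) p) = L (wedge (\<nu> p) (ddx (ddx \<nu>) p))"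
    if "\<And>q. q \<in> D \<Longrightarrow> wedge (f q) (ddx f q) = L (wedge (\<nu> q) (ddx \<nu> q))"
    using has_vector_derivative_unique_ev[OF
        wedge[OF dx[OF assms(2)] dx[OF smooth_on_ddx[OF assms(2)]]]
        L[OF wedge[OF dx[OF assms(3)] dx[OF smooth_on_ddx[OF assms(3)]]]]
        eventually_mono[OF slices(1) that]] by simp
  show "wedge (f p) (ddy (ddy f) p) = L (wedge (\<nu> p) (ddy (ddy \<nu>) p))"
    if "\<And>q. q \<in> D \<Longrightarrow> wedge (f q) (ddy f q) = L (wedge (\<nu> q) (ddy \<nu> q))"
    using has_vector_derivative_unique_ev[OF
        wedge[OF dy[OF assms(2)] dy[OF smooth_on_ddy[OF assms(2)]]]
        L[OF wedge[OF dy[OF assms(3)] dy[OF smooth_on_ddy[OF assms(3)]]]]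
        eventually_mono[OF slices(2) that]] by simp
qed

section \<open>The second-order equations for \<nu> and f\<close>

theorem theorem2p3:
  fixes D :: "(real \<times> real) set" and f \<nu> :: "real \<times> real \<Rightarrow> real ^ 4"
  assumes "open D"
    and "smooth_on D f" and "smooth_on D \<nu>"
    and "\<And>p. p \<in> D \<Longrightarrow> f p \<noteq> 0" and "\<And>p. p \<in> D \<Longrightarrow> \<nu> p \<noteq> 0"
    and "\<And>p. p \<in> D \<Longrightarrow> f p \<bullet> \<nu> p = 0"
    and "\<And>p. p \<in> D \<Longrightarrow> wedge (f p) (ddx f p) = hodge_star (wedge (\<nu> p) (ddx \<nu> p))"
    and "\<And>p. p \<in> D \<Longrightarrow> wedge (f p) (ddy f p) = - hodge_star (wedge (\<nu> p) (ddy \<nu> p))"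
    and "\<And>p. p \<in> D \<Longrightarrow> det4 (\<nu> p) (ddx \<nu> p) (ddy \<nu> p) (ddy (ddx \<nu>) p) \<noteq> 0"
  shows "\<exists>U1 V1 W1 W1' U2 V2 W2 W2' :: real \<times> real \<Rightarrow> real. \<forall>p\<in>D.
    ddx (ddx \<nu>) p = U1 p *\<^sub>R ddx \<nu> p + V1 p *\<^sub>R ddy \<nu> p + W1 p *\<^sub>R \<nu> p \<and>
    ddy (ddy \<nu>) p = U2 p *\<^sub>R ddx \<nu> p + V2 p *\<^sub>R ddy \<nu> p + W2 p *\<^sub>R \<nu> p \<and>
    ddx (ddx f) p = U1 p *\<^sub>R ddx f p - V1 p *\<^sub>R ddy f p + W1' p *\<^sub>R f p \<and>
    ddy (ddy f) p = - U2 p *\<^sub>R ddx f p + V2 p *\<^sub>R ddy f p + W2' p *\<^sub>R f p \<and>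
    (V1 p)\<^sup>2 = det4 (\<nu> p) (ddx \<nu> p) (ddx (ddx \<nu>) p) (ddx (ddx (ddx \<nu>)) p)
              / det4 (\<nu> p) (ddx \<nu> p) (ddy \<nu> p) (ddy (ddx \<nu>) p) \<and>
    (U2 p)\<^sup>2 = - (det4 (\<nu> p) (ddy \<nu> p) (ddy (ddy \<nu>) p) (ddy (ddy (ddy \<nu>)) p)
                / det4 (\<nu> p) (ddx \<nu> p) (ddy \<nu> p) (ddy (ddx \<nu>) p))"
proof -
  note oD = assms(1) and f0 = assms(4) and fn = assms(6) and wx = assms(7) and wy = assms(8)
  have px: "(f p \<bullet> a) * (ddx f p \<bullet> b) - (ddx f p \<bullet> a) * (f p \<bullet> b) = det4 (\<nu> p) (ddx \<nu> p) a b"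
    if "p \<in> D" for p a b
    using wx[OF that] by (metis inner_wedge inner_hodge_star_wedge)
  have py: "(f p \<bullet> a) * (ddy f p \<bullet> b) - (ddy f p \<bullet> a) * (f p \<bullet> b) = - det4 (\<nu> p) (ddy \<nu> p) a b"
    if "p \<in> D" for p a b
  proof -
    have "a \<bullet> (wedge (f p) (ddy f p) *v b) = - (a \<bullet> (hodge_star (wedge (\<nu> p) (ddy \<nu> p)) *v b))"
      unfolding wy[OF that] by (simp add: inner_vec_def matrix_vector_mult_def sum_negf)
    then show ?thesis by (simp add: inner_wedge inner_hodge_star_wedge)
  qed
  \<comment> \<open>With test vectors f and \<nu> the determinants have a repeated row, and f
    \<bullet> \<nu> = 0 leaves only the factor f \<bullet> f, which is nonzero.\<close>
  have fxn: "ddx f p \<bullet> \<nu> p = 0" and fyn: "ddy f p \<bullet> \<nu> p = 0" if "p \<in> D" for p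
    using px[OF that, of "f p" "\<nu> p"] py[OF that, of "f p" "\<nu> p"] that f0 fn by auto
  have fnx: "f p \<bullet> ddx \<nu> p = 0" and fny: "f p \<bullet> ddy \<nu> p = 0" if "p \<in> D" for p
    using inner_eq_0_derivatives[OF oD assms(2,3) fn that] fxn fyn that by auto
  have fxnx: "ddx f p \<bullet> ddx \<nu> p = 0" and fyny: "ddy f p \<bullet> ddy \<nu> p = 0" if "p \<in> D" for p
    using px[OF that, of "f p" "ddx \<nu> p"] py[OF that, of "f p" "ddy \<nu> p"] that f0 fnx fny by auto
  have fnxx: "f p \<bullet> ddx (ddx \<nu>) p = 0" and fnyy: "f p \<bullet> ddy (ddy \<nu>) p = 0" if "p \<in> D" for p
    using inner_eq_0_derivatives(1)[OF oD assms(2) smooth_on_ddx[OF assms(3)] fnx that]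
      inner_eq_0_derivatives(2)[OF oD assms(2) smooth_on_ddy[OF assms(3)] fny that] fxnx fyny that by auto
  \<comment> \<open>The coefficients are found point by point; choice then makes them
    functions.\<close>
  have "\<forall>p\<in>D. \<exists>U1 V1 W1 W1' U2 V2 W2 W2'.
    ddx (ddx \<nu>) p = U1 *\<^sub>R ddx \<nu> p + V1 *\<^sub>R ddy \<nu> p + W1 *\<^sub>R \<nu> p \<and>
    ddy (ddy \<nu>) p = U2 *\<^sub>R ddx \<nu> p + V2 *\<^sub>R ddy \<nu> p + W2 *\<^sub>R \<nu> p \<and>
    ddx (ddx f) p = U1 *\<^sub>R ddx f p - V1 *\<^sub>R ddy f p + W1' *\<^sub>R f p \<and>
    ddy (ddy f) p = - U2 *\<^sub>R ddx f p + V2 *\<^sub>R ddy f p + W2' *\<^sub>R f p \<and>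
    V1\<^sup>2 = det4 (\<nu> p) (ddx \<nu> p) (ddx (ddx \<nu>) p) (ddx (ddx (ddx \<nu>)) p)
              / det4 (\<nu> p) (ddx \<nu> p) (ddy \<nu> p) (ddy (ddx \<nu>) p) \<and>
    U2\<^sup>2 = - (det4 (\<nu> p) (ddy \<nu> p) (ddy (ddy \<nu>) p) (ddy (ddy (ddy \<nu>)) p)
                / det4 (\<nu> p) (ddx \<nu> p) (ddy \<nu> p) (ddy (ddx \<nu>) p))"
  proof
    fix p assume p: "p \<in> D"
    define r where "r = ddx f p \<bullet> ddy \<nu> p"
    let ?\<Delta> = "det4 (\<nu> p) (ddx \<nu> p) (ddy \<nu> p) (ddy (ddx \<nu>) p)"
    note orth = fxn[OF p] fyn[OF p] fnx[OF p] fny[OF p] fxnx[OF p] fyny[OF p] fnxx[OF p] fnyy[OF p] fn[OF p]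
    have ff: "f p \<bullet> f p \<noteq> 0" using f0[OF p] by simp
    \<comment> \<open>The two sides are |\<nu>, \<nu>_x, f, \<nu>_y| and -|\<nu>, \<nu>_y, f,
      \<nu>_x|, which agree by exchanging \<nu>_x and \<nu>_y.\<close>
    have "(f p \<bullet> f p) * r = (f p \<bullet> f p) * (ddy f p \<bullet> ddx \<nu> p)"
      using px[OF p, of "f p" "ddy \<nu> p"] py[OF p, of "f p" "ddx \<nu> p"]
        det4_swap(2)[of "\<nu> p" "ddx \<nu> p" "f p" "ddy \<nu> p"]
        det4_swap(3)[of "\<nu> p" "f p" "ddx \<nu> p" "ddy \<nu> p"]
        det4_swap(2)[of "\<nu> p" "f p" "ddy \<nu> p" "ddx \<nu> p"] orth
      by (simp add: r_def)
    then have r: "ddy f p \<bullet> ddx \<nu> p = r" using ff by simp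
    have fdet: "det4 (\<nu> p) (ddx \<nu> p) (ddy \<nu> p) w = - (f p \<bullet> w) * r" for w
      using px[OF p, of w "ddy \<nu> p"] det4_swap(3)[of "\<nu> p" "ddx \<nu> p" "ddy \<nu> p" w] orth
      by (simp add: r_def)
    have "f p \<bullet> ddy (ddx \<nu>) p = - r"
      using inner_eq_0_derivatives(2)[OF oD assms(2) smooth_on_ddx[OF assms(3)] fnx p] r by simp
    \<comment> \<open>Take w = \<nu>_xy in \<open>fdet\<close>. As the determinant is nonzero, so is
      r.\<close>
    then have \<Delta>: "?\<Delta> = r\<^sup>2" and fnxy: "f p \<bullet> ddy (ddx \<nu>) p \<noteq> 0"
      using assms(9)[OF p] fdet by (auto simp: power2_eq_square)
    have span: "\<exists>u v w. x = u *\<^sub>R ddx \<nu> p + v *\<^sub>R ddy \<nu> p + w *\<^sub>R \<nu> p" if "f p \<bullet> x = 0" for x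
    proof -
      obtain \<alpha> \<beta> \<gamma> \<delta> where x: "x = \<alpha> *\<^sub>R \<nu> p + \<beta> *\<^sub>R ddx \<nu> p + \<gamma> *\<^sub>R ddy \<nu> p + \<delta> *\<^sub>R ddy (ddx \<nu>) p"
        using det4_nonzero_spans[OF assms(9)[OF p]] .
      \<comment> \<open>Pairing with f kills every basis vector except \<nu>_xy.\<close>
      have "\<delta> = 0" using that fnxy orth by (simp add: x inner_add_right)
      then have "x = \<beta> *\<^sub>R ddx \<nu> p + \<gamma> *\<^sub>R ddy \<nu> p + \<alpha> *\<^sub>R \<nu> p" by (simp add: x add_ac)
      then show ?thesis by blast
    qed
    obtain U1 V1 W1 where nxx: "ddx (ddx \<nu>) p = U1 *\<^sub>R ddx \<nu> p + V1 *\<^sub>R ddy \<nu> p + W1 *\<^sub>R \<nu> p"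
      using span fnxx[OF p] by blast
    obtain U2 V2 W2 where nyy: "ddy (ddy \<nu>) p = U2 *\<^sub>R ddx \<nu> p + V2 *\<^sub>R ddy \<nu> p + W2 *\<^sub>R \<nu> p"
      using span fnyy[OF p] by blast
    note wedge_simps = linear_add[OF linear_wedge_right]
      linear_diff[OF linear_wedge_right] linear_scale[OF linear_wedge_right]
      linear_add[OF linear_hodge_star] linear_scale[OF linear_hodge_star]
    have wx': "hodge_star (wedge (\<nu> p) (ddx \<nu> p)) = wedge (f p) (ddx f p)"
      and wy': "hodge_star (wedge (\<nu> p) (ddy \<nu> p)) = - wedge (f p) (ddy f p)"
      using wx[OF p] wy[OF p] by simp_all
    have "wedge (f p) (ddx (ddx f) p) = hodge_star (wedge (\<nu> p) (ddx (ddx \<nu>) p))"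
      by (rule lelieuvre_derivatives(1)[OF oD assms(2,3) linear_hodge_star p wx])
    \<comment> \<open>The \<nu> component drops out because \<nu> \<and> \<nu> = 0; the minus sign
      in \<open>wy'\<close> is what reverses the sign of \<open>V1\<close>.\<close>
    then have "wedge (f p) (ddx (ddx f) p - (U1 *\<^sub>R ddx f p - V1 *\<^sub>R ddy f p)) = 0"
      by (simp add: nxx wedge_simps wx' wy')
    then obtain W1' where "ddx (ddx f) p - (U1 *\<^sub>R ddx f p - V1 *\<^sub>R ddy f p) = W1' *\<^sub>R f p"
      using f0[OF p] by (rule wedge_eq_0_imp_multiple)
    then have fxx: "ddx (ddx f) p = U1 *\<^sub>R ddx f p - V1 *\<^sub>R ddy f p + W1' *\<^sub>R f p"
      by (simp add: diff_eq_eq add.commute)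
    have "wedge (f p) (ddy (ddy f) p) = - hodge_star (wedge (\<nu> p) (ddy (ddy \<nu>) p))"
      by (rule lelieuvre_derivatives(2)[OF oD assms(2,3) linear_compose_neg[OF linear_hodge_star] p wy])
    \<comment> \<open>The outer minus sign now cancels the one in \<open>wy'\<close>, so it is
      \<open>U2\<close> that changes sign.\<close>
    then have "wedge (f p) (ddy (ddy f) p - (- U2 *\<^sub>R ddx f p + V2 *\<^sub>R ddy f p)) = 0"
      by (simp add: nyy wedge_simps wx' wy')
    then obtain W2' where "ddy (ddy f) p - (- U2 *\<^sub>R ddx f p + V2 *\<^sub>R ddy f p) = W2' *\<^sub>R f p"
      using f0[OF p] by (rule wedge_eq_0_imp_multiple)
    then have fyy: "ddy (ddy f) p = - U2 *\<^sub>R ddx f p + V2 *\<^sub>R ddy f p + W2' *\<^sub>R f p"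
      unfolding diff_eq_eq by (simp only: add.commute)
    \<comment> \<open>Differentiating f \<bullet> \<nu>_xx = 0 gives -f_x \<bullet> \<nu>_xx, where
      f_x is orthogonal to \<nu> and \<nu>_x.\<close>
    have "f p \<bullet> ddx (ddx (ddx \<nu>)) p = - V1 * r"
      using inner_eq_0_derivatives(1)[OF oD assms(2) smooth_on_ddx[OF smooth_on_ddx[OF assms(3)]] fnxx p] orth
      by (simp add: nxx inner_add_right r_def)
    then have "det4 (\<nu> p) (ddx \<nu> p) (ddx (ddx \<nu>) p) (ddx (ddx (ddx \<nu>)) p) = V1\<^sup>2 * ?\<Delta>"
      unfolding \<Delta> by (simp add: nxx det4_linear_simps fdet power2_eq_square)
    then have V1: "V1\<^sup>2 = det4 (\<nu> p) (ddx \<nu> p) (ddx (ddx \<nu>) p) (ddx (ddx (ddx \<nu>)) p) / ?\<Delta>"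
      using assms(9)[OF p] by simp
    \<comment> \<open>Here the symmetry \<open>r\<close> supplies f_y \<bullet> \<nu>_x.\<close>
    have "f p \<bullet> ddy (ddy (ddy \<nu>)) p = - U2 * r"
      using inner_eq_0_derivatives(2)[OF oD assms(2) smooth_on_ddy[OF smooth_on_ddy[OF assms(3)]] fnyy p] orth
      by (simp add: nyy inner_add_right r)
    \<comment> \<open>Moving \<nu>_x in front of \<nu>_y to apply \<open>fdet\<close> produces the
      minus sign absent from the formula for \<open>V1\<close>.\<close>
    then have "det4 (\<nu> p) (ddy \<nu> p) (ddy (ddy \<nu>) p) (ddy (ddy (ddy \<nu>)) p) = - (U2\<^sup>2 * ?\<Delta>)"
      unfolding \<Delta> by (simp add: nyy det4_linear_simps det4_swap(2)[of _ "ddy \<nu> p" "ddx \<nu> p"] fdet power2_eq_square)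
    then have U2: "U2\<^sup>2 = - (det4 (\<nu> p) (ddy \<nu> p) (ddy (ddy \<nu>) p) (ddy (ddy (ddy \<nu>)) p) / ?\<Delta>)"
      using assms(9)[OF p] by simp
    show "\<exists>U1 V1 W1 W1' U2 V2 W2 W2'.
        ddx (ddx \<nu>) p = U1 *\<^sub>R ddx \<nu> p + V1 *\<^sub>R ddy \<nu> p + W1 *\<^sub>R \<nu> p \<and>
        ddy (ddy \<nu>) p = U2 *\<^sub>R ddx \<nu> p + V2 *\<^sub>R ddy \<nu> p + W2 *\<^sub>R \<nu> p \<and>
        ddx (ddx f) p = U1 *\<^sub>R ddx f p - V1 *\<^sub>R ddy f p + W1' *\<^sub>R f p \<and>
        ddy (ddy f) p = - U2 *\<^sub>R ddx f p + V2 *\<^sub>R ddy f p + W2' *\<^sub>R f p \<and>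
        V1\<^sup>2 = det4 (\<nu> p) (ddx \<nu> p) (ddx (ddx \<nu>) p) (ddx (ddx (ddx \<nu>)) p)
                  / det4 (\<nu> p) (ddx \<nu> p) (ddy \<nu> p) (ddy (ddx \<nu>) p) \<and>
        U2\<^sup>2 = - (det4 (\<nu> p) (ddy \<nu> p) (ddy (ddy \<nu>) p) (ddy (ddy (ddy \<nu>)) p)
                    / det4 (\<nu> p) (ddx \<nu> p) (ddy \<nu> p) (ddy (ddx \<nu>) p))"
      by (intro exI conjI, rule nxx, rule nyy, rule fxx, rule fyy, rule V1, rule U2)
  qed
  then show ?thesis
    unfolding bchoice_iff by assumption
qed

end
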